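(* Let $\mathbf m,\mathbf n$ be two strictly increasing sequences of positive integers such that the difference set $\Delta_{\mathbf m,\mathbf n}$ is infinite. Then there exists a $1$-unconditional basis $\mathcal B$ (of some Banach space) that is (i) ($\mathbf n$, strong partially greedy); (ii) not ($\mathbf m$, strong partially greedy); (iii) not ($\mathbf n$, democratic).
   Context: The sequences $\mathbf m,\mathbf n$ are identified with their sets of terms, and $\Delta_{\mathbf m,\mathbf n}=\{i:i\in\mathbf m,i\notin\mathbf n\}\cup\{i:i\in\mathbf n,i\notin\mathbf m\}$ is their symmetric difference. Banach spaces are separable, infinite-dimensional, over $\mathbb F=\mathbb R$ or $\mathbb C$; $\mathbb N=\{1,2,\dots\}$. A basis of $X$ is a sequence $\mathcal B=(e_n)_{n\ge1}\subset X$ whose linear span is norm-dense and for which there is a sequence $(e_n^* )_{n\ge1}\subset X^*$ with $e_j^*(e_k)=\delta_{j,k}$ and $0<\inf_n\{\|e_n\|,\|e_n^*\|\}\le\sup_n\{\|e_n\|,\|e_n^*\|\}<\infty$. It is $1$-unconditional if for all $N\in\mathbb N$, $\|\sum_{n=1}^Na_ne_n\|\le\|\sum_{n=1}^Nb_ne_n\|$ whenever $|a_n|\le|b_n|$ for $1\le n\le N$. For a finite set $A\subset\mathbb N$, $P_A(x)=\sum_{n\in A}e_n^*(x)e_n$ and $1_A=\sum_{n\in A}e_n$. For $x\in X$, $m\in\mathbb N$, a greedy set of $x$ of order $m$ is a set $A\subset\mathbb N$ with $|A|=m$ and $\min_{n\in A}|e_n^*(x)|\ge\max_{n\notin A}|e_n^*(x)|$;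 $G_m(x)$ denotes $P_A(x)$ for such an $A$ (not necessarily unique). For $\mathbf n=(n_k)_{k\ge1}$ put $P^{\mathbf n}_0(x)=0$, $P^{\mathbf n}_k(x)=\sum_{i=1}^k e_{n_i}^*(x)e_{n_i}$, and $\widehat\sigma^{\mathbf n}_m(x)=\min_{0\le k\le m}\|x-P^{\mathbf n}_k(x)\|$. $\mathcal B$ is ($\mathbf n$, strong partially greedy) if there is $C\ge1$ with $\|x-G_m(x)\|\le C\,\widehat\sigma^{\mathbf n}_m(x)$ for all $x\in X$, $m\in\mathbb N$ and all choices of $G_m(x)$ (and likewise for $\mathbf m$). $\mathcal B$ is ($\mathbf n$, democratic) if there is $C\ge1$ with $\|1_A\|\le C\|1_B\|$ for all finite sets $A,B\subset\mathbb N$ with $A\subset\mathbf n$ and $|A|\le|B|$. *)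

theory Defs
  imports "HOL-Analysis.Analysis" "HOL-Library.Function_Algebras"
begin

text \<open>
  Normed spaces over a scalar field \<open>'k\<close> (used below for \<open>real\<close> and \<open>complex\<close>) are given by a
  carrier: a linear subspace \<open>X\<close> of an ambient vector space together with a norm \<open>N\<close> on \<open>X\<close>.
  This makes it possible to assert the existence of a Banach space inside a formula.
  Values of \<open>N\<close> outside \<open>X\<close> are irrelevant.
\<close>

locale normed_space_on = vector_space scale
  for scale :: "'k::real_normed_field \<Rightarrow> 'v::ab_group_add \<Rightarrow> 'v" (infixr "*s" 75) +
  fixes X :: "'v set" and N :: "'v \<Rightarrow> real"
  assumes subspace_X: "subspace X"
    and N_nonneg: "x \<in> X \<Longrightarrow> 0 \<le> N x"
    and N_eq_0_iff: "x \<in> X \<Longrightarrow> N x = 0 \<longleftrightarrow> x = 0"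
    and N_scale: "x \<in> X \<Longrightarrow> N (c *s x) = norm c * N x"
    and N_triangle: "x \<in> X \<Longrightarrow> y \<in> X \<Longrightarrow> N (x + y) \<le> N x + N y"
begin

text \<open>Cut off outside \<open>X\<close> because \<open>Metric_space\<close> wants a symmetric, nonnegative distance on the
  whole type.\<close>

definition ndist :: "'v \<Rightarrow> 'v \<Rightarrow> real" where
  "ndist x y = (if x \<in> X \<and> y \<in> X then N (x - y) else 0)"

sublocale Metric_space X ndist
proof
  have diff: "x - y \<in> X" if "x \<in> X" "y \<in> X" for x y
    using subspace_X that by (rule subspace_diff)
  show "0 \<le> ndist x y" for x y
    by (simp add: ndist_def N_nonneg diff)
  show "ndist x y = ndist y x" for x y
  proof (cases "x \<in> X \<and> y \<in> X")
    case True
    have "N ((- 1) *s (y - x)) = norm (- 1 :: 'k) * N (y - x)"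
      using True by (intro N_scale diff) auto
    then show ?thesis
      using True by (simp add: ndist_def scale_minus_left)
  qed (auto simp: ndist_def)
  show "ndist x y = 0 \<longleftrightarrow> x = y" if "x \<in> X" "y \<in> X" for x y
    using that by (simp add: ndist_def N_eq_0_iff diff)
  show "ndist x z \<le> ndist x y + ndist y z" if "x \<in> X" "y \<in> X" "z \<in> X" for x y z
    using N_triangle[of "x - y" "y - z"] that by (simp add: ndist_def diff)
qed

definition dual :: "('v \<Rightarrow> 'k) set" where
  "dual = {\<phi>. (\<forall>x\<in>X. \<forall>y\<in>X. \<phi> (x + y) = \<phi> x + \<phi> y) \<and>
              (\<forall>c. \<forall>x\<in>X. \<phi> (c *s x) = c * \<phi> x) \<and>
              (\<exists>K. \<forall>x\<in>X. norm (\<phi> x) \<le> K * N x)}"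

definition dual_norm :: "('v \<Rightarrow> 'k) \<Rightarrow> real" where
  "dual_norm \<phi> = (SUP x\<in>{x \<in> X. N x \<le> 1}. norm (\<phi> x))"

end

locale banach_space_on = normed_space_on +
  assumes complete: "mcomplete"
    and separable: "separable_space mtopology"
    and infinite_dim: "\<not> (\<exists>B. finite B \<and> B \<subseteq> X \<and> span B = X)"

text \<open>A basis \<open>e\<close> with its biorthogonal functionals \<open>es\<close>. All sequences are indexed by
  \<open>{1..}\<close>, the positive integers; values at index 0 are irrelevant. The functionals are determined
  on \<open>X\<close> by \<open>e\<close>, since the span of \<open>e\<close> is dense.\<close>

locale banach_basis = banach_space_on scale X N
  for scale :: "'k::real_normed_field \<Rightarrow> 'v::ab_group_add \<Rightarrow> 'v" (infixr "*s" 75)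
    and X :: "'v set" and N :: "'v \<Rightarrow> real" +
  fixes e :: "nat \<Rightarrow> 'v" and es :: "nat \<Rightarrow> 'v \<Rightarrow> 'k"
  assumes e_in: "i \<ge> 1 \<Longrightarrow> e i \<in> X"
    and es_in: "i \<ge> 1 \<Longrightarrow> es i \<in> dual"
    and dense: "mtopology closure_of (span (e ` {1..})) = X"
    and biorthogonal: "i \<ge> 1 \<Longrightarrow> j \<ge> 1 \<Longrightarrow> es i (e j) = (if i = j then 1 else 0)"
    and seminormalized: "\<exists>c>0. \<exists>C. \<forall>i\<ge>1. c \<le> N (e i) \<and> N (e i) \<le> C \<and>
                            c \<le> dual_norm (es i) \<and> dual_norm (es i) \<le> C"
begin

definition one_unconditional :: bool where
  "one_unconditional \<longleftrightarrow>
     (\<forall>L\<ge>1. \<forall>a b :: nat \<Rightarrow> 'k. (\<forall>i\<in>{1..L}. norm (a i) \<le> norm (b i)) \<longrightarrow>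
        N (\<Sum>i=1..L. a i *s e i) \<le> N (\<Sum>i=1..L. b i *s e i))"

definition proj :: "nat set \<Rightarrow> 'v \<Rightarrow> 'v" where
  "proj A x = (\<Sum>i\<in>A. es i x *s e i)"

definition greedy_set :: "'v \<Rightarrow> nat \<Rightarrow> nat set \<Rightarrow> bool" where
  "greedy_set x r A \<longleftrightarrow> A \<subseteq> {1..} \<and> finite A \<and> card A = r \<and>
     (\<forall>i\<in>A. \<forall>j\<in>{1..} - A. norm (es j x) \<le> norm (es i x))"

definition seq_psum :: "(nat \<Rightarrow> nat) \<Rightarrow> nat \<Rightarrow> 'v \<Rightarrow> 'v" where
  "seq_psum n k x = (\<Sum>i=1..k. es (n i) x *s e (n i))"

definition sigma_hat :: "(nat \<Rightarrow> nat) \<Rightarrow> nat \<Rightarrow> 'v \<Rightarrow> real" where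
  "sigma_hat n r x = (MIN k\<in>{0..r}. N (x - seq_psum n k x))"

definition strong_partially_greedy :: "(nat \<Rightarrow> nat) \<Rightarrow> bool" where
  "strong_partially_greedy n \<longleftrightarrow>
     (\<exists>C\<ge>1. \<forall>x\<in>X. \<forall>r\<ge>1. \<forall>A. greedy_set x r A \<longrightarrow> N (x - proj A x) \<le> C * sigma_hat n r x)"

definition democratic :: "(nat \<Rightarrow> nat) \<Rightarrow> bool" where
  "democratic n \<longleftrightarrow>
     (\<exists>C\<ge>1. \<forall>A B. finite A \<and> finite B \<and> A \<subseteq> {1..} \<and> B \<subseteq> {1..} \<and> A \<subseteq> n ` {1..} \<and>
        card A \<le> card B \<longrightarrow> N (\<Sum>i\<in>A. e i) \<le> C * N (\<Sum>i\<in>B. e i))"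

end

text \<open>The ambient vector space of all scalar sequences. Its dimension is that of the continuum, so
  every separable Banach space is linearly isomorphic to a carrier \<open>X\<close> inside it.\<close>

definition seq_scale :: "'k::real_normed_field \<Rightarrow> (nat \<Rightarrow> 'k) \<Rightarrow> (nat \<Rightarrow> 'k)" where
  "seq_scale c x = (\<lambda>i. c * x i)"

end

theory Submission
  imports Defs
begin

text \<open>
  The basis is the unit vector basis of a combinatorial Banach space. For a hereditary family
  \<open>\<F>\<close> of finite sets of positive integers that contains the singletons, put
  \<open>\<parallel>x\<parallel> = sup {\<Sum>i\<in>S. |x i| | S. S \<in> \<F>}\<close> and complete the finitely supported sequences. The
  unit vectors are then a normalized 1-unconditional basis, whatever \<open>\<F>\<close> is, and all three
  properties become statements about \<open>\<F>\<close>, since \<open>\<parallel>1\<^sub>A\<parallel>\<close> is the largest cardinality of a member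
  of \<open>\<F>\<close> inside \<open>A\<close>.

  Let \<open>J\<close> be the set of terms of \<open>n\<close>. The family admits \<open>S\<close> if \<open>|S| \<le> h i + 1\<close> for all
  \<open>i \<in> S \<inter> J\<close>, with \<open>h\<close> nondecreasing and unbounded: the norm is that of \<open>\<ell>\<^sub>1\<close> on coordinates
  outside \<open>J\<close>, while inside \<open>J\<close> early sets are small and late sets are large. Then:

  \<^item> If \<open>S\<close> is admissible and contained in \<open>{n 1, ..., n k}\<close>, every set of the same cardinality that
    avoids \<open>{n 1, ..., n k}\<close> is admissible too, because its elements in \<open>J\<close> come after all of \<open>S\<close>.
    With 1-unconditionality this yields strong partial greediness along \<open>n\<close> with constant 2
    (\<open>strong_partially_greedy_if_later_sets\<close>, \<open>slow_family_shift_later\<close>).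

  \<^item> Choose \<open>F\<close> in \<open>J\<close> of size \<open>(j + 1)\<^sup>2\<close> on which \<open>h \<le> j\<close>; then \<open>\<parallel>1\<^sub>F\<parallel> \<le> j + 1\<close>. A set \<open>E\<close> of
    the same size whose elements in \<open>J\<close> are all late is itself admissible, so
    \<open>\<parallel>1\<^sub>E\<parallel> \<ge> (j + 1)\<^sup>2\<close>. Taking \<open>E \<subseteq> J\<close> refutes democracy along \<open>n\<close>.

  \<^item> If in addition \<open>E \<subseteq> {m 1, ..., m k}\<close> and \<open>F\<close> is disjoint from \<open>{m 1, ..., m k}\<close>, the same two
    sets refute strong partial greediness along \<open>m\<close>. This is where the infinite symmetric
    difference enters (\<open>obtain_separating_sets\<close>): if infinitely many terms of \<open>m\<close> lie outside
    \<open>n\<close>, put \<open>E\<close> there; if infinitely many terms of \<open>n\<close> lie outside \<open>m\<close>, put \<open>F\<close> there and \<open>E\<close>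
    far out in \<open>m\<close>.

  Since the sets \<open>F\<close> do not depend on \<open>h\<close>, the function \<open>h\<close> can be made to grow as slowly as they
  require (\<open>slow_function_exists\<close>).
\<close>

section \<open>The Banach space of a hereditary family of finite sets\<close>

definition family_norm :: "nat set set \<Rightarrow> (nat \<Rightarrow> 'k::real_normed_field) \<Rightarrow> real" where
  "family_norm \<F> x = (SUP S\<in>\<F>. \<Sum>i\<in>S. norm (x i))"

text \<open>Small tails describe the closure of the finitely supported sequences. Coordinate 0 is forced to
  vanish because the basis is indexed by the positive integers.\<close>

definition family_space :: "nat set set \<Rightarrow> (nat \<Rightarrow> 'k::real_normed_field) set" where
  "family_space \<F> = {x. x 0 = 0 \<and>
     (\<forall>\<epsilon>>0. \<exists>L. \<forall>S\<in>\<F>. (\<forall>i\<in>S. L < i) \<longrightarrow> (\<Sum>i\<in>S. norm (x i)) \<le> \<epsilon>)}"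

definition coord_vec :: "nat \<Rightarrow> nat \<Rightarrow> 'k::real_normed_field" where
  "coord_vec i = (\<lambda>j. if j = i then 1 else 0)"

lemma vector_space_seq_scale: "vector_space (seq_scale :: 'k::real_normed_field \<Rightarrow> _)"
  by unfold_locales (auto simp: seq_scale_def fun_eq_iff algebra_simps)

lemma sum_fun_apply: "(\<Sum>i\<in>A. f i) j = (\<Sum>i\<in>A. f i j)"
  for f :: "'i \<Rightarrow> nat \<Rightarrow> 'k::real_normed_field"
  by (induction A rule: infinite_finite_induct) auto

lemma sum_seq_scale_coord_vec:
  assumes "finite A"
  shows "(\<Sum>i\<in>A. seq_scale (a i) (coord_vec i)) = (\<lambda>j. if j \<in> A then a j else 0)"
proof
  fix j
  have "(\<Sum>i\<in>A. seq_scale (a i) (coord_vec i)) j = (\<Sum>i\<in>A. if j = i then a i else 0)"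
    unfolding sum_fun_apply by (intro sum.cong) (auto simp: seq_scale_def coord_vec_def)
  then show "(\<Sum>i\<in>A. seq_scale (a i) (coord_vec i)) j = (if j \<in> A then a j else 0)"
    using assms by (simp add: sum.delta')
qed

locale hereditary_family =
  fixes \<F> :: "nat set set"
  assumes finite_sets: "S \<in> \<F> \<Longrightarrow> finite S"
    and positive_sets: "S \<in> \<F> \<Longrightarrow> S \<subseteq> {1..}"
    and hereditary: "S \<in> \<F> \<Longrightarrow> T \<subseteq> S \<Longrightarrow> T \<in> \<F>"
    and singletons: "i \<ge> 1 \<Longrightarrow> {i} \<in> \<F>"
begin

lemma empty_in: "{} \<in> \<F>"
  using hereditary[OF singletons[of 1]] by simp

lemma bdd_above_sums:
  assumes "x \<in> family_space \<F>"
  shows "bdd_above ((\<lambda>S. \<Sum>i\<in>S. norm (x i)) ` \<F>)"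
proof -
  have "\<exists>L. \<forall>S\<in>\<F>. (\<forall>i\<in>S. L < i) \<longrightarrow> (\<Sum>i\<in>S. norm (x i)) \<le> 1"
    using assms unfolding family_space_def by (auto dest: spec[of _ "1::real"])
  then obtain L where L: "\<And>S. S \<in> \<F> \<Longrightarrow> (\<forall>i\<in>S. L < i) \<Longrightarrow> (\<Sum>i\<in>S. norm (x i)) \<le> 1"
    by blast
  have "(\<Sum>i\<in>S. norm (x i)) \<le> (\<Sum>i\<le>L. norm (x i)) + 1" if "S \<in> \<F>" for S
  proof -
    have "(\<Sum>i\<in>S. norm (x i)) = (\<Sum>i\<in>S \<inter> {..L}. norm (x i)) + (\<Sum>i\<in>S - {..L}. norm (x i))"
      using finite_sets[OF that] by (simp add: sum.Int_Diff)
    moreover have "(\<Sum>i\<in>S \<inter> {..L}. norm (x i)) \<le> (\<Sum>i\<le>L. norm (x i))"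
      by (intro sum_mono2) auto
    moreover have "(\<Sum>i\<in>S - {..L}. norm (x i)) \<le> 1"
      using L hereditary[OF that] by auto
    ultimately show ?thesis by linarith
  qed
  then show ?thesis by (intro bdd_aboveI2)
qed

lemma sum_le_family_norm:
  assumes "x \<in> family_space \<F>" "S \<in> \<F>"
  shows "(\<Sum>i\<in>S. norm (x i)) \<le> family_norm \<F> x"
  unfolding family_norm_def using assms by (intro cSUP_upper bdd_above_sums)

lemma family_norm_le:
  assumes "\<And>S. S \<in> \<F> \<Longrightarrow> (\<Sum>i\<in>S. norm (x i)) \<le> K"
  shows "family_norm \<F> x \<le> K"
  unfolding family_norm_def using empty_in assms by (intro cSUP_least) auto

lemma norm_coordinate_le:
  assumes "x \<in> family_space \<F>" "i \<ge> 1"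
  shows "norm (x i) \<le> family_norm \<F> x"
  using sum_le_family_norm[OF assms(1) singletons[OF assms(2)]] by simp

lemma family_space_at_0: "x \<in> family_space \<F> \<Longrightarrow> x 0 = 0"
  by (simp add: family_space_def)

lemma family_space_tail:
  assumes "x \<in> family_space \<F>" "\<epsilon> > 0"
  obtains L where "\<And>S. S \<in> \<F> \<Longrightarrow> (\<And>i. i \<in> S \<Longrightarrow> L < i) \<Longrightarrow> (\<Sum>i\<in>S. norm (x i)) \<le> \<epsilon>"
  using assms unfolding family_space_def by (simp add: Ball_def) metis

lemma family_space_solid:
  assumes "y \<in> family_space \<F>" "x 0 = 0" "\<And>i. i \<ge> 1 \<Longrightarrow> norm (x i) \<le> norm (y i)"
  shows "x \<in> family_space \<F>"
  unfolding family_space_def mem_Collect_eq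
proof (intro conjI allI impI)
  fix \<epsilon> :: real assume "\<epsilon> > 0"
  from family_space_tail[OF assms(1) this] obtain L
    where L: "\<And>S. S \<in> \<F> \<Longrightarrow> (\<And>i. i \<in> S \<Longrightarrow> L < i) \<Longrightarrow> (\<Sum>i\<in>S. norm (y i)) \<le> \<epsilon>"
    by metis
  have "(\<Sum>i\<in>S. norm (x i)) \<le> \<epsilon>" if S: "S \<in> \<F>" "\<forall>i\<in>S. L < i" for S
  proof -
    have "(\<Sum>i\<in>S. norm (x i)) \<le> (\<Sum>i\<in>S. norm (y i))"
      using S by (intro sum_mono assms(3)) force
    then show ?thesis using L[of S] S by force
  qed
  then show "\<exists>L. \<forall>S\<in>\<F>. (\<forall>i\<in>S. L < i) \<longrightarrow> (\<Sum>i\<in>S. norm (x i)) \<le> \<epsilon>" by blast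
qed (rule assms(2))

lemma family_norm_mono:
  assumes "y \<in> family_space \<F>" "\<And>i. i \<ge> 1 \<Longrightarrow> norm (x i) \<le> norm (y i)"
  shows "family_norm \<F> x \<le> family_norm \<F> y"
proof (rule family_norm_le)
  fix S assume S: "S \<in> \<F>"
  have "(\<Sum>i\<in>S. norm (x i)) \<le> (\<Sum>i\<in>S. norm (y i))"
    using positive_sets[OF S] by (intro sum_mono assms(2)) auto
  also have "\<dots> \<le> family_norm \<F> y" by (rule sum_le_family_norm[OF assms(1) S])
  finally show "(\<Sum>i\<in>S. norm (x i)) \<le> family_norm \<F> y" .
qed

lemma finitely_supported_in_family_space:
  assumes "x 0 = 0" "\<And>i. i > L \<Longrightarrow> x i = 0"
  shows "x \<in> family_space \<F>"
  using assms unfolding family_space_def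
  by (auto intro!: exI[of _ L] order.trans[OF eq_refl[OF sum.neutral]])

lemma coord_vec_in: "i \<ge> 1 \<Longrightarrow> coord_vec i \<in> family_space \<F>"
  by (rule finitely_supported_in_family_space[of _ i]) (auto simp: coord_vec_def)

lemma family_space_add:
  assumes "x \<in> family_space \<F>" "y \<in> family_space \<F>"
  shows "x + y \<in> family_space \<F>"
  unfolding family_space_def mem_Collect_eq
proof (intro conjI allI impI)
  show "(x + y) 0 = 0" using assms by (simp add: family_space_at_0)
  fix \<epsilon> :: real assume "\<epsilon> > 0"
  then have e2: "\<epsilon> / 2 > 0" by simp
  from family_space_tail[OF assms(1) e2] obtain L
    where L: "\<And>S. S \<in> \<F> \<Longrightarrow> (\<And>i. i \<in> S \<Longrightarrow> L < i) \<Longrightarrow> (\<Sum>i\<in>S. norm (x i)) \<le> \<epsilon> / 2"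
    by metis
  from family_space_tail[OF assms(2) e2] obtain L'
    where L': "\<And>S. S \<in> \<F> \<Longrightarrow> (\<And>i. i \<in> S \<Longrightarrow> L' < i) \<Longrightarrow> (\<Sum>i\<in>S. norm (y i)) \<le> \<epsilon> / 2"
    by metis
  have "(\<Sum>i\<in>S. norm ((x + y) i)) \<le> \<epsilon>" if S: "S \<in> \<F>" "\<forall>i\<in>S. max L L' < i" for S
  proof -
    have "(\<Sum>i\<in>S. norm ((x + y) i)) \<le> (\<Sum>i\<in>S. norm (x i)) + (\<Sum>i\<in>S. norm (y i))"
      unfolding sum.distrib[symmetric] by (intro sum_mono) (simp add: norm_triangle_ineq)
    then show ?thesis using L[of S] L'[of S] S by force
  qed
  then show "\<exists>L. \<forall>S\<in>\<F>. (\<forall>i\<in>S. L < i) \<longrightarrow> (\<Sum>i\<in>S. norm ((x + y) i)) \<le> \<epsilon>" by blast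
qed

lemma family_space_scale:
  assumes "x \<in> family_space \<F>"
  shows "seq_scale c x \<in> family_space \<F>"
  unfolding family_space_def mem_Collect_eq
proof (intro conjI allI impI)
  show "seq_scale c x 0 = 0" using assms by (simp add: family_space_at_0 seq_scale_def)
  fix \<epsilon> :: real assume e: "\<epsilon> > 0"
  have "\<epsilon> / (norm c + 1) > 0"
    using e by (simp add: add_nonneg_pos)
  from family_space_tail[OF assms this] obtain L
    where L: "\<And>S. S \<in> \<F> \<Longrightarrow> (\<And>i. i \<in> S \<Longrightarrow> L < i) \<Longrightarrow>
                (\<Sum>i\<in>S. norm (x i)) \<le> \<epsilon> / (norm c + 1)"
    by metis
  have "(\<Sum>i\<in>S. norm (seq_scale c x i)) \<le> \<epsilon>" if S: "S \<in> \<F>" "\<forall>i\<in>S. L < i" for S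
  proof -
    have "(\<Sum>i\<in>S. norm (seq_scale c x i)) = norm c * (\<Sum>i\<in>S. norm (x i))"
      by (simp add: seq_scale_def norm_mult sum_distrib_left)
    also have "\<dots> \<le> (norm c + 1) * (\<epsilon> / (norm c + 1))"
      using L[of S] S by (intro mult_mono) (auto intro: sum_nonneg)
    also have "\<dots> = \<epsilon>" by (simp add: add_nonneg_eq_0_iff)
    finally show ?thesis .
  qed
  then show "\<exists>L. \<forall>S\<in>\<F>. (\<forall>i\<in>S. L < i) \<longrightarrow> (\<Sum>i\<in>S. norm (seq_scale c x i)) \<le> \<epsilon>" by blast
qed

lemma family_norm_scale:
  assumes x: "x \<in> family_space \<F>"
  shows "family_norm \<F> (seq_scale c x) = norm c * family_norm \<F> x"
proof -
  have upper: "family_norm \<F> (seq_scale d y) \<le> norm d * family_norm \<F> y"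
    if y: "y \<in> family_space \<F>" for d and y :: "nat \<Rightarrow> 'a"
  proof (rule family_norm_le)
    fix S assume "S \<in> \<F>"
    have "(\<Sum>i\<in>S. norm (seq_scale d y i)) = norm d * (\<Sum>i\<in>S. norm (y i))"
      by (simp add: seq_scale_def norm_mult sum_distrib_left)
    then show "(\<Sum>i\<in>S. norm (seq_scale d y i)) \<le> norm d * family_norm \<F> y"
      using sum_le_family_norm[OF y \<open>S \<in> \<F>\<close>] by (simp add: mult_left_mono)
  qed
  show ?thesis
  proof (cases "c = 0")
    case True
    have "family_norm \<F> (seq_scale c x) = 0"
      unfolding family_norm_def using True empty_in by (simp add: seq_scale_def) (metis cSUP_const empty_iff)
    then show ?thesis using True by simp
  next
    case False
    have "family_norm \<F> x = family_norm \<F> (seq_scale (inverse c) (seq_scale c x))"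
      using False by (simp add: seq_scale_def mult.assoc[symmetric])
    also have "\<dots> \<le> norm (inverse c) * family_norm \<F> (seq_scale c x)"
      by (rule upper[OF family_space_scale[OF x]])
    finally have "norm c * family_norm \<F> x \<le> family_norm \<F> (seq_scale c x)"
      using False by (simp only: norm_inverse) (simp add: field_simps)
    then show ?thesis using upper[OF x, of c] by simp
  qed
qed

lemma normed_space_on_family_space:
  "normed_space_on seq_scale (family_space \<F> :: (nat \<Rightarrow> 'k::real_normed_field) set) (family_norm \<F>)"
proof -
  interpret vector_space "seq_scale :: 'k \<Rightarrow> _" by (rule vector_space_seq_scale)
  show ?thesis
  proof
    show "subspace (family_space \<F>)"
      by (intro subspaceI finitely_supported_in_family_space[of 0 0]
            family_space_add family_space_scale) auto
    fix x y :: "nat \<Rightarrow> 'k" and c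
    assume x: "x \<in> family_space \<F>"
    show nonneg: "0 \<le> family_norm \<F> x"
      using sum_le_family_norm[OF x empty_in] by simp
    show "family_norm \<F> x = 0 \<longleftrightarrow> x = 0"
    proof
      assume N: "family_norm \<F> x = 0"
      have "x i = 0" for i
        using norm_coordinate_le[OF x, of i] N family_space_at_0[OF x] by (cases "i = 0") auto
      then show "x = 0" by auto
    next
      assume "x = 0"
      then have "family_norm \<F> x \<le> 0" by (intro family_norm_le) simp
      with nonneg show "family_norm \<F> x = 0" by simp
    qed
    show "family_norm \<F> (seq_scale c x) = norm c * family_norm \<F> x"
      by (rule family_norm_scale[OF x])
    assume y: "y \<in> family_space \<F>"
    show "family_norm \<F> (x + y) \<le> family_norm \<F> x + family_norm \<F> y"
    proof (rule family_norm_le)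
      fix S assume S: "S \<in> \<F>"
      have "(\<Sum>i\<in>S. norm ((x + y) i)) \<le> (\<Sum>i\<in>S. norm (x i)) + (\<Sum>i\<in>S. norm (y i))"
        unfolding sum.distrib[symmetric] by (intro sum_mono) (simp add: norm_triangle_ineq)
      then show "(\<Sum>i\<in>S. norm ((x + y) i)) \<le> family_norm \<F> x + family_norm \<F> y"
        using sum_le_family_norm[OF x S] sum_le_family_norm[OF y S] by linarith
    qed
  qed
qed

lemma family_space_diff:
  fixes x y :: "nat \<Rightarrow> 'k::real_normed_field"
  assumes "x \<in> family_space \<F>" "y \<in> family_space \<F>"
  shows "x - y \<in> family_space \<F>"
proof -
  interpret normed_space_on seq_scale "family_space \<F> :: (nat \<Rightarrow> 'k) set" "family_norm \<F>"
    by (rule normed_space_on_family_space)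
  show ?thesis using subspace_X assms by (rule subspace_diff)
qed

text \<open>Once the tail of \<open>x\<close> beyond \<open>L\<close> is small, a vector supported on \<open>{1..L}\<close> is close to \<open>x\<close> as soon
  as it is close coordinatewise. Density of the span and separability both rest on this.\<close>

lemma truncation_approximates:
  assumes x: "x \<in> family_space \<F>" and e: "\<epsilon> > 0"
  obtains L where "\<And>y. y 0 = 0 \<Longrightarrow> (\<And>i. i > L \<Longrightarrow> y i = 0) \<Longrightarrow>
      family_norm \<F> (x - y) \<le> \<epsilon> + (\<Sum>i=1..L. norm (x i - y i))"
proof -
  from family_space_tail[OF x e] obtain L
    where L: "\<And>S. S \<in> \<F> \<Longrightarrow> (\<And>i. i \<in> S \<Longrightarrow> L < i) \<Longrightarrow> (\<Sum>i\<in>S. norm (x i)) \<le> \<epsilon>"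
    by metis
  have "family_norm \<F> (x - y) \<le> \<epsilon> + (\<Sum>i=1..L. norm (x i - y i))"
    if y: "y 0 = 0" "\<And>i. i > L \<Longrightarrow> y i = 0" for y
  proof (rule family_norm_le)
    fix S assume S: "S \<in> \<F>"
    have "(\<Sum>i\<in>S. norm ((x - y) i)) =
        (\<Sum>i\<in>S \<inter> {1..L}. norm (x i - y i)) + (\<Sum>i\<in>S - {1..L}. norm (x i - y i))"
      using finite_sets[OF S] by (simp add: sum.Int_Diff)
    moreover have "(\<Sum>i\<in>S \<inter> {1..L}. norm (x i - y i)) \<le> (\<Sum>i=1..L. norm (x i - y i))"
      by (intro sum_mono2) auto
    moreover have late: "L < i" if "i \<in> S - {1..L}" for i
      using positive_sets[OF S] that by auto
    have "(\<Sum>i\<in>S - {1..L}. norm (x i - y i)) = (\<Sum>i\<in>S - {1..L}. norm (x i))"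
      by (intro sum.cong) (use y late in auto)
    moreover have "(\<Sum>i\<in>S - {1..L}. norm (x i)) \<le> \<epsilon>"
      using late by (intro L hereditary[OF S]) auto
    ultimately show "(\<Sum>i\<in>S. norm ((x - y) i)) \<le> \<epsilon> + (\<Sum>i=1..L. norm (x i - y i))"
      by linarith
  qed
  then show thesis by (rule that)
qed

text \<open>A Cauchy sequence converges in each coordinate, and the finite sums over members of \<open>\<F>\<close> pass to
  the limit, uniformly over \<open>\<F>\<close>. Hence the coordinatewise limit is close in norm to a late member of
  the sequence, and it inherits small tails from that member.\<close>

lemma mcomplete_family_space:
  "Metric_space.mcomplete (family_space \<F> :: (nat \<Rightarrow> 'k::{real_normed_field,banach}) set)
     (normed_space_on.ndist (family_space \<F>) (family_norm \<F>))"
proof -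
  interpret normed_space_on seq_scale "family_space \<F> :: (nat \<Rightarrow> 'k) set" "family_norm \<F>"
    by (rule normed_space_on_family_space)
  show ?thesis
    unfolding mcomplete_def
  proof (intro allI impI)
    fix \<sigma> :: "nat \<Rightarrow> nat \<Rightarrow> 'k"
    assume "MCauchy \<sigma>"
    then have \<sigma>: "\<And>r. \<sigma> r \<in> family_space \<F>"
      and cauchy: "\<And>\<epsilon>. 0 < \<epsilon> \<Longrightarrow> \<exists>K. \<forall>r\<ge>K. \<forall>s\<ge>K. family_norm \<F> (\<sigma> r - \<sigma> s) < \<epsilon>"
      by (force simp: MCauchy_def ndist_def image_subset_iff)+
    have coordinate_cauchy: "Cauchy (\<lambda>r. \<sigma> r i)" if "i \<ge> 1" for i
    proof (rule metric_CauchyI)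
      fix \<epsilon> :: real assume "\<epsilon> > 0"
      from cauchy[OF this] obtain K where "\<forall>r\<ge>K. \<forall>s\<ge>K. family_norm \<F> (\<sigma> r - \<sigma> s) < \<epsilon>" ..
      then show "\<exists>K. \<forall>r\<ge>K. \<forall>s\<ge>K. dist (\<sigma> r i) (\<sigma> s i) < \<epsilon>"
        using norm_coordinate_le[OF family_space_diff[OF \<sigma> \<sigma>] that]
        by (metis dist_norm le_less_trans minus_apply)
    qed
    define y where "y i = (if i = 0 then 0 else lim (\<lambda>r. \<sigma> r i))" for i
    have lim: "(\<lambda>r. \<sigma> r i) \<longlonglongrightarrow> y i" if "i \<ge> 1" for i
      using Cauchy_convergent[OF coordinate_cauchy[OF that]] that
      by (simp add: y_def convergent_LIMSEQ_iff)
    have uniform: "\<exists>K. \<forall>r\<ge>K. \<forall>S\<in>\<F>. (\<Sum>i\<in>S. norm (\<sigma> r i - y i)) \<le> \<epsilon>" if "\<epsilon> > 0" for \<epsilon>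
    proof -
      from cauchy[OF that] obtain K
        where K: "\<And>r s. r \<ge> K \<Longrightarrow> s \<ge> K \<Longrightarrow> family_norm \<F> (\<sigma> r - \<sigma> s) < \<epsilon>" by blast
      have "(\<Sum>i\<in>S. norm (\<sigma> r i - y i)) \<le> \<epsilon>" if r: "r \<ge> K" and S: "S \<in> \<F>" for r S
      proof (rule LIMSEQ_le_const2)
        show "(\<lambda>s. \<Sum>i\<in>S. norm (\<sigma> r i - \<sigma> s i)) \<longlonglongrightarrow> (\<Sum>i\<in>S. norm (\<sigma> r i - y i))"
          by (intro tendsto_sum tendsto_norm tendsto_diff tendsto_const lim)
            (use positive_sets[OF S] in auto)
        show "\<exists>N. \<forall>s\<ge>N. (\<Sum>i\<in>S. norm (\<sigma> r i - \<sigma> s i)) \<le> \<epsilon>"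
        proof (intro exI[of _ K] allI impI)
          fix s assume "s \<ge> K"
          show "(\<Sum>i\<in>S. norm (\<sigma> r i - \<sigma> s i)) \<le> \<epsilon>"
            using sum_le_family_norm[OF family_space_diff[OF \<sigma> \<sigma>] S, of r s]
              K[OF r \<open>s \<ge> K\<close>] by simp
        qed
      qed
      then show ?thesis by blast
    qed
    have "y \<in> family_space \<F>"
      unfolding family_space_def mem_Collect_eq
    proof (intro conjI allI impI)
      show "y 0 = 0" by (simp add: y_def)
      fix \<epsilon> :: real assume "\<epsilon> > 0"
      then have e2: "\<epsilon> / 2 > 0" by simp
      from uniform[OF e2] obtain K
        where K: "\<And>S. S \<in> \<F> \<Longrightarrow> (\<Sum>i\<in>S. norm (\<sigma> K i - y i)) \<le> \<epsilon> / 2" by blast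
      from family_space_tail[OF \<sigma> e2, of K] obtain L
        where L: "\<And>S. S \<in> \<F> \<Longrightarrow> (\<And>i. i \<in> S \<Longrightarrow> L < i) \<Longrightarrow> (\<Sum>i\<in>S. norm (\<sigma> K i)) \<le> \<epsilon> / 2"
        by metis
      have "(\<Sum>i\<in>S. norm (y i)) \<le> \<epsilon>" if S: "S \<in> \<F>" "\<forall>i\<in>S. L < i" for S
      proof -
        have "(\<Sum>i\<in>S. norm (y i)) \<le> (\<Sum>i\<in>S. norm (\<sigma> K i)) + (\<Sum>i\<in>S. norm (\<sigma> K i - y i))"
          unfolding sum.distrib[symmetric]
          by (intro sum_mono) (metis norm_minus_commute norm_triangle_sub)
        then show ?thesis using K[of S] L[of S] S by force
      qed
      then show "\<exists>L. \<forall>S\<in>\<F>. (\<forall>i\<in>S. L < i) \<longrightarrow> (\<Sum>i\<in>S. norm (y i)) \<le> \<epsilon>" by blast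
    qed
    moreover have "\<exists>K. \<forall>r\<ge>K. \<sigma> r \<in> family_space \<F> \<and> ndist (\<sigma> r) y < \<epsilon>" if "\<epsilon> > 0" for \<epsilon>
    proof -
      from that have e2: "\<epsilon> / 2 > 0" by simp
      from uniform[OF e2] obtain K
        where K: "\<And>r S. r \<ge> K \<Longrightarrow> S \<in> \<F> \<Longrightarrow> (\<Sum>i\<in>S. norm (\<sigma> r i - y i)) \<le> \<epsilon> / 2" by blast
      have "family_norm \<F> (\<sigma> r - y) \<le> \<epsilon> / 2" if "r \<ge> K" for r
        using K[OF that] by (intro family_norm_le) simp
      then show ?thesis
        using \<sigma> \<open>y \<in> family_space \<F>\<close> that by (intro exI[of _ K]) (fastforce simp: ndist_def)
    qed
    ultimately show "\<exists>y. limitin mtopology \<sigma> y sequentially"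
      unfolding limit_metric_sequentially by blast
  qed
qed

lemma closure_family_space:
  fixes C :: "(nat \<Rightarrow> 'k::real_normed_field) set"
  assumes "\<And>x \<epsilon>. x \<in> family_space \<F> \<Longrightarrow> \<epsilon> > 0 \<Longrightarrow>
      \<exists>y\<in>C. y \<in> family_space \<F> \<and> family_norm \<F> (x - y) < \<epsilon>"
  shows "Metric_space.mtopology (family_space \<F>)
      (normed_space_on.ndist (family_space \<F>) (family_norm \<F>)) closure_of C = family_space \<F>"
proof -
  interpret normed_space_on seq_scale "family_space \<F> :: (nat \<Rightarrow> 'k) set" "family_norm \<F>"
    by (rule normed_space_on_family_space)
  show ?thesis
    unfolding metric_closure_of using assms by (fastforce simp: ndist_def)
qed

text \<open>Finitely supported sequences with entries from a countable dense set of scalars are dense: with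
  \<open>L\<close> relevant coordinates, each of them only has to be matched up to
  \<open>\<epsilon> / (3 * (L + 1))\<close>.\<close>

lemma separable_family_space:
  "separable_space (Metric_space.mtopology
     (family_space \<F> :: (nat \<Rightarrow> 'k::{real_normed_field,second_countable_topology}) set)
     (normed_space_on.ndist (family_space \<F>) (family_norm \<F>)))"
proof -
  interpret normed_space_on seq_scale "family_space \<F> :: (nat \<Rightarrow> 'k) set" "family_norm \<F>"
    by (rule normed_space_on_family_space)
  obtain D :: "'k set" where D: "countable D" "\<And>U. open U \<Longrightarrow> U \<noteq> {} \<Longrightarrow> \<exists>d\<in>D. d \<in> U"
    by (rule countable_dense_setE) blast
  define C where "C = (\<Union>L. (\<lambda>f i :: nat. if i \<in> {1..L} then f i else 0) ` ({1..L} \<rightarrow>\<^sub>E D))"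
  have "countable C"
    unfolding C_def using D(1) by (intro countable_UN countable_image countable_PiE ballI) auto
  moreover have CX: "C \<subseteq> family_space \<F>"
  proof
    fix y assume "y \<in> C"
    then obtain L f where "y = (\<lambda>i. if i \<in> {1..L} then f i else 0)" by (auto simp: C_def)
    then show "y \<in> family_space \<F>"
      by (intro finitely_supported_in_family_space[of _ L]) auto
  qed
  moreover have "mtopology closure_of C = family_space \<F>"
  proof (rule closure_family_space)
    fix x :: "nat \<Rightarrow> 'k" and \<epsilon> :: real
    assume x: "x \<in> family_space \<F>" and "\<epsilon> > 0"
    then have e3: "\<epsilon> / 3 > 0" by simp
    obtain L where L: "\<And>y. y 0 = 0 \<Longrightarrow> (\<And>i. i > L \<Longrightarrow> y i = 0) \<Longrightarrow>
      family_norm \<F> (x - y) \<le> \<epsilon> / 3 + (\<Sum>i=1..L. norm (x i - y i))"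
      using truncation_approximates[OF x e3] by metis
    define \<delta> where "\<delta> = \<epsilon> / (3 * (real L + 1))"
    have "\<delta> > 0" using \<open>\<epsilon> > 0\<close> by (simp add: \<delta>_def)
    have "\<exists>d\<in>D. d \<in> ball (x i) \<delta>" for i
      using \<open>\<delta> > 0\<close> by (intro D(2)) auto
    then obtain q where q: "\<And>i. q i \<in> D" "\<And>i. dist (x i) (q i) < \<delta>"
      by (metis mem_ball)
    define y where "y = (\<lambda>i. if i \<in> {1..L} then q i else 0)"
    have "y \<in> C"
      unfolding C_def
      by (intro UN_I[of L] image_eqI[of _ _ "restrict q {1..L}"]) (auto simp: y_def q)
    have "(\<Sum>i=1..L. norm (x i - y i)) \<le> (\<Sum>i=1..L. \<delta>)"
      using q(2) by (intro sum_mono) (auto simp: y_def dist_norm intro: less_imp_le)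
    also have "\<dots> \<le> (real L + 1) * \<delta>" using \<open>\<delta> > 0\<close> by simp
    also have "\<dots> = \<epsilon> / 3" by (simp add: \<delta>_def field_simps)
    finally have "family_norm \<F> (x - y) \<le> \<epsilon> / 3 + \<epsilon> / 3"
      using L[of y] by (force simp: y_def)
    also have "\<dots> < \<epsilon>" using \<open>\<epsilon> > 0\<close> by simp
    finally have "family_norm \<F> (x - y) < \<epsilon>" .
    then show "\<exists>y\<in>C. y \<in> family_space \<F> \<and> family_norm \<F> (x - y) < \<epsilon>"
      using \<open>y \<in> C\<close> CX by blast
  qed
  ultimately show ?thesis unfolding separable_space_def by auto
qed

lemma family_norm_coord_vec:
  assumes "i \<ge> 1"
  shows "family_norm \<F> (coord_vec i) = 1"
proof (rule antisym)
  show "family_norm \<F> (coord_vec i) \<le> 1"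
    by (rule family_norm_le) (simp add: coord_vec_def if_distrib finite_sets cong: if_cong)
  show "1 \<le> family_norm \<F> (coord_vec i)"
    using norm_coordinate_le[OF coord_vec_in[OF assms] assms] by (simp add: coord_vec_def)
qed

lemma infinite_dimensional_family_space:
  "\<not> (\<exists>B. finite B \<and> B \<subseteq> family_space \<F> \<and>
        module.span (seq_scale :: 'k::real_normed_field \<Rightarrow> _) B = family_space \<F>)"
proof -
  interpret vector_space "seq_scale :: 'k \<Rightarrow> _" by (rule vector_space_seq_scale)
  let ?E = "coord_vec ` {1..} :: (nat \<Rightarrow> 'k) set"
  have inj: "inj_on (coord_vec :: nat \<Rightarrow> nat \<Rightarrow> 'k) {1..}"
    by (rule inj_onI) (metis coord_vec_def zero_neq_one)
  have "independent ?E"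
    unfolding dependent_def
  proof clarify
    fix i :: nat assume i: "coord_vec i \<in> span (?E - {coord_vec i :: nat \<Rightarrow> 'k})"
    have "subspace {x :: nat \<Rightarrow> 'k. x i = 0}"
      by (rule subspaceI) (auto simp: seq_scale_def)
    moreover have "?E - {coord_vec i} \<subseteq> {x. x i = 0}" by (auto simp: coord_vec_def)
    ultimately have "span (?E - {coord_vec i}) \<subseteq> {x. x i = 0}" by (intro span_minimal)
    then show False using i by (auto simp: coord_vec_def)
  qed
  moreover have "infinite ?E"
    using finite_image_iff[OF inj] infinite_Ici by blast
  moreover have "?E \<subseteq> family_space \<F>" by (auto intro: coord_vec_in)
  ultimately show ?thesis using independent_span_bound by metis
qed

lemma banach_basis_coord_vec:
  "banach_basis seq_scale
     (family_space \<F> :: (nat \<Rightarrow> 'k::{real_normed_field,banach,second_countable_topology}) set)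
     (family_norm \<F>) coord_vec (\<lambda>i x. x i)"
proof -
  interpret normed_space_on seq_scale "family_space \<F> :: (nat \<Rightarrow> 'k) set" "family_norm \<F>"
    by (rule normed_space_on_family_space)
  interpret banach_space_on seq_scale "family_space \<F> :: (nat \<Rightarrow> 'k) set" "family_norm \<F>"
    by unfold_locales
      (rule mcomplete_family_space separable_family_space infinite_dimensional_family_space)+
  have dual_norm: "dual_norm (\<lambda>x. x i) = 1" if "i \<ge> 1" for i
    unfolding dual_norm_def
  proof (rule cSup_eq_maximum)
    show "1 \<in> (\<lambda>x. norm (x i)) ` {x \<in> family_space \<F>. family_norm \<F> x \<le> 1}"
      using that by (intro image_eqI[of _ _ "coord_vec i"])
        (auto simp: family_norm_coord_vec coord_vec_in, simp add: coord_vec_def)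
    show "t \<le> 1" if "t \<in> (\<lambda>x. norm (x i)) ` {x \<in> family_space \<F>. family_norm \<F> x \<le> 1}" for t
      using that norm_coordinate_le[OF _ \<open>i \<ge> 1\<close>] by force
  qed
  show ?thesis
  proof
    show "coord_vec i \<in> family_space \<F>" if "i \<ge> 1" for i by (rule coord_vec_in[OF that])
    show "(\<lambda>x. x i) \<in> dual" if "i \<ge> 1" for i
      using norm_coordinate_le[OF _ that] unfolding dual_def
      by (auto simp: seq_scale_def intro!: exI[of _ 1])
    show "mtopology closure_of span (coord_vec ` {1..}) = family_space \<F>"
    proof (rule closure_family_space)
      fix x :: "nat \<Rightarrow> 'k" and \<epsilon> :: real
      assume x: "x \<in> family_space \<F>" and "\<epsilon> > 0"
      then have e2: "\<epsilon> / 2 > 0" by simp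
      obtain L where L: "\<And>y. y 0 = 0 \<Longrightarrow> (\<And>i. i > L \<Longrightarrow> y i = 0) \<Longrightarrow>
        family_norm \<F> (x - y) \<le> \<epsilon> / 2 + (\<Sum>i=1..L. norm (x i - y i))"
        using truncation_approximates[OF x e2] by metis
      define y where "y = (\<Sum>i\<in>{1..L}. seq_scale (x i) (coord_vec i))"
      have y: "y i = (if i \<in> {1..L} then x i else 0)" for i
        by (simp add: y_def sum_seq_scale_coord_vec)
      have "y \<in> span (coord_vec ` {1..})"
        unfolding y_def by (intro span_sum span_scale span_base) auto
      moreover have "y \<in> family_space \<F>"
        by (rule finitely_supported_in_family_space[of _ L]) (auto simp: y)
      moreover have "family_norm \<F> (x - y) \<le> \<epsilon> / 2"
        using L[of y] by (simp add: y)
      ultimately show "\<exists>y\<in>span (coord_vec ` {1..}). y \<in> family_space \<F> \<and>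
          family_norm \<F> (x - y) < \<epsilon>"
        using \<open>\<epsilon> > 0\<close> by (intro bexI[of _ y]) auto
    qed
    show "coord_vec j i = (if i = j then 1 else 0)" for i j by (simp add: coord_vec_def)
    show "\<exists>c>0. \<exists>C. \<forall>i\<ge>1. c \<le> family_norm \<F> (coord_vec i) \<and> family_norm \<F> (coord_vec i) \<le> C \<and>
        c \<le> dual_norm (\<lambda>x. x i) \<and> dual_norm (\<lambda>x. x i) \<le> C"
      by (intro exI[of _ 1] conjI exI[of _ 1]) (auto simp: dual_norm family_norm_coord_vec)
  qed
qed

lemma one_unconditional_coord_vec:
  "banach_basis.one_unconditional
     (seq_scale :: 'k::{real_normed_field,banach,second_countable_topology} \<Rightarrow> _)
     (family_norm \<F>) coord_vec"
  unfolding banach_basis.one_unconditional_def[OF banach_basis_coord_vec]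
    sum_seq_scale_coord_vec[OF finite_atLeastAtMost]
proof (intro allI impI)
  fix L :: nat and a b :: "nat \<Rightarrow> 'k"
  assume "\<forall>i\<in>{1..L}. norm (a i) \<le> norm (b i)"
  then show "family_norm \<F> (\<lambda>j. if j \<in> {1..L} then a j else 0)
      \<le> family_norm \<F> (\<lambda>j. if j \<in> {1..L} then b j else 0)"
    by (intro family_norm_mono finitely_supported_in_family_space[of _ L]) auto
qed

section \<open>Greediness and democracy in terms of the family\<close>

lemma card_le_family_norm_indicator:
  assumes "S \<in> \<F>"
  shows "real (card S) \<le> family_norm \<F> (\<lambda>i. if i \<in> S then 1 else 0 :: 'k::real_normed_field)"
proof -
  have "(\<Sum>i\<in>S. norm (if i \<in> S then 1 else 0 :: 'k)) = real (card S)" by simp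
  moreover have "(\<lambda>i. if i \<in> S then 1 else 0 :: 'k) \<in> family_space \<F>"
    using finite_sets[OF assms] positive_sets[OF assms]
    by (intro finitely_supported_in_family_space[of _ "Max S"]) (auto simp: leD)
  ultimately show ?thesis using sum_le_family_norm[OF _ assms] by metis
qed

lemma family_norm_indicator_le:
  assumes "\<And>S. S \<in> \<F> \<Longrightarrow> card (S \<inter> A) \<le> K"
  shows "family_norm \<F> (\<lambda>i. if i \<in> A then 1 else 0 :: 'k::real_normed_field) \<le> real K"
proof (rule family_norm_le)
  fix S assume S: "S \<in> \<F>"
  have "(\<Sum>i\<in>S. norm (if i \<in> A then 1 else 0 :: 'k)) = (\<Sum>i\<in>S. if i \<in> A then 1 else 0)"
    by (intro sum.cong) auto
  also have "\<dots> = real (card (S \<inter> A))"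
    using finite_sets[OF S] by (simp add: sum.inter_restrict[symmetric])
  finally show "(\<Sum>i\<in>S. norm (if i \<in> A then 1 else 0 :: 'k)) \<le> real K" using assms[OF S] by simp
qed

lemma seq_psum_coord_vec:
  fixes x :: "nat \<Rightarrow> 'k::{real_normed_field,banach,second_countable_topology}"
  assumes "inj_on n {1..}"
  shows "banach_basis.seq_psum seq_scale coord_vec (\<lambda>i x. x i) n k x =
    (\<lambda>i. if i \<in> n ` {1..k} then x i else 0)"
proof -
  have "inj_on n {1..k}" using assms by (rule inj_on_subset) auto
  then have "(\<Sum>i=1..k. seq_scale (x (n i)) (coord_vec (n i))) =
      (\<Sum>i\<in>n ` {1..k}. seq_scale (x i) (coord_vec i))"
    by (simp add: sum.reindex)
  then show ?thesis
    by (simp add: banach_basis.seq_psum_def[OF banach_basis_coord_vec] sum_seq_scale_coord_vec)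
qed

text \<open>Compare \<open>x - P\<^sub>A x\<close> with \<open>z = x - P\<^sub>D x\<close>, where \<open>D = n ` {1..k}\<close> and \<open>k \<le> |A|\<close>. On a member \<open>S\<close>
  of \<open>\<F>\<close>, the part outside \<open>D\<close> is dominated by \<open>z\<close>. The part in \<open>D - A\<close> has at most \<open>|A - D|\<close>
  elements and carries coefficients no larger than those on \<open>A\<close>, so it can be exchanged for a subset
  of \<open>A - D\<close> of the same size; by assumption this subset belongs to \<open>\<F>\<close> again, and there the
  coefficients of \<open>x\<close> and \<open>z\<close> agree. Each part contributes at most the norm of \<open>z\<close>.\<close>

lemma strong_partially_greedy_if_later_sets:
  assumes inj: "inj_on n {1..}"
    and later: "\<And>k S T. S \<in> \<F> \<Longrightarrow> S \<subseteq> n ` {1..k} \<Longrightarrow> finite T \<Longrightarrow> T \<subseteq> {1..} - n ` {1..k} \<Longrightarrow>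
      card T = card S \<Longrightarrow> T \<in> \<F>"
  shows "banach_basis.strong_partially_greedy
     (seq_scale :: 'k::{real_normed_field,banach,second_countable_topology} \<Rightarrow> _)
     (family_space \<F>) (family_norm \<F>) coord_vec (\<lambda>i x. x i) n"
  unfolding banach_basis.strong_partially_greedy_def[OF banach_basis_coord_vec]
proof (intro exI[of _ 2] conjI ballI allI impI)
  interpret banach_basis seq_scale "family_space \<F> :: (nat \<Rightarrow> 'k) set" "family_norm \<F>"
    coord_vec "\<lambda>i x. x i"
    by (rule banach_basis_coord_vec)
  fix x :: "nat \<Rightarrow> 'k" and r A
  assume x: "x \<in> family_space \<F>" and "r \<ge> 1" and "greedy_set x r A"
  then have A: "A \<subseteq> {1..}" "finite A" "card A = r"
    and greedy: "\<And>i j. i \<in> A \<Longrightarrow> j \<in> {1..} - A \<Longrightarrow> norm (x j) \<le> norm (x i)"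
    by (auto simp: greedy_set_def)
  have "Min ((\<lambda>k. family_norm \<F> (x - seq_psum n k x)) ` {0..r})
      \<in> (\<lambda>k. family_norm \<F> (x - seq_psum n k x)) ` {0..r}"
    by (intro Min_in) auto
  then obtain k where k: "k \<le> r" "sigma_hat n r x = family_norm \<F> (x - seq_psum n k x)"
    unfolding sigma_hat_def by (metis (no_types, lifting) atLeastAtMost_iff imageE)
  define D where "D = n ` {1..k}"
  have "card D \<le> r"
    using card_image_le[of "{1..k}" n] k(1) by (simp add: D_def)
  have "finite D" by (simp add: D_def)
  define z where "z = x - seq_psum n k x"
  have z: "z i = (if i \<in> D then 0 else x i)" for i
    by (simp add: z_def seq_psum_coord_vec[OF inj] D_def)
  have zX: "z \<in> family_space \<F>"
    by (rule family_space_solid[OF x]) (auto simp: z family_space_at_0[OF x])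
  have y: "(x - proj A x) i = (if i \<in> A then 0 else x i)" for i
    by (simp add: proj_def sum_seq_scale_coord_vec[OF A(2)])
  have "family_norm \<F> (x - proj A x) \<le> 2 * family_norm \<F> z"
  proof (rule family_norm_le)
    fix S assume S: "S \<in> \<F>"
    note [simp] = finite_sets[OF S]
    define T0 where "T0 = (S \<inter> D) - A"
    have T0: "T0 \<in> \<F>" "finite T0" "T0 \<subseteq> D" "T0 \<inter> A = {}"
      using hereditary[OF S, of T0] by (auto simp: T0_def)
    have "card T0 \<le> card (D - A)"
      using \<open>finite D\<close> by (intro card_mono) (auto simp: T0_def)
    also have "\<dots> \<le> card (A - D)"
    proof -
      have "card (A - D) + card (A \<inter> D) = card A" "card (D - A) + card (A \<inter> D) = card D"
        using \<open>finite D\<close> A(2) by (metis add.commute card_Int_Diff Int_commute)+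
      then show ?thesis using \<open>card D \<le> r\<close> A(3) by linarith
    qed
    finally obtain T where T: "T \<subseteq> A - D" "card T = card T0" "finite T"
      using obtain_subset_with_card_n by metis
    have "T \<in> \<F>"
      using T A(1) T0 by (intro later[of T0 k T]) (auto simp: D_def)
    obtain f where f: "bij_betw f T0 T"
      using finite_same_card_bij[OF T0(2) T(3)] T(2) by metis
    have "(\<Sum>i\<in>T0. norm (x i)) \<le> (\<Sum>i\<in>T0. norm (x (f i)))"
    proof (intro sum_mono greedy)
      show "f i \<in> A" if "i \<in> T0" for i using bij_betwE[OF f] that T(1) by blast
      show "i \<in> {1..} - A" if "i \<in> T0" for i using that T0 positive_sets[OF T0(1)] by blast
    qed
    also have "\<dots> = (\<Sum>i\<in>T. norm (x i))"
      by (rule sum.reindex_bij_betw[OF f])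
    also have "\<dots> = (\<Sum>i\<in>T. norm (z i))"
      using T(1) by (intro sum.cong) (auto simp: z)
    also have "\<dots> \<le> family_norm \<F> z"
      by (rule sum_le_family_norm[OF zX \<open>T \<in> \<F>\<close>])
    finally have head: "(\<Sum>i\<in>T0. norm (x i)) \<le> family_norm \<F> z" .
    have "(\<Sum>i\<in>S. norm ((x - proj A x) i)) \<le> (\<Sum>i\<in>S. norm (z i) + (if i \<in> T0 then norm (x i) else 0))"
      unfolding y by (intro sum_mono) (auto simp: z T0_def)
    also have "\<dots> = (\<Sum>i\<in>S. norm (z i)) + (\<Sum>i\<in>S \<inter> T0. norm (x i))"
      by (simp add: sum.distrib sum.inter_restrict)
    also have "S \<inter> T0 = T0" by (auto simp: T0_def)
    also have "(\<Sum>i\<in>S. norm (z i)) + (\<Sum>i\<in>T0. norm (x i)) \<le> 2 * family_norm \<F> z"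
      using head sum_le_family_norm[OF zX S] by linarith
    finally show "(\<Sum>i\<in>S. norm ((x - proj A x) i)) \<le> 2 * family_norm \<F> z" .
  qed
  then show "family_norm \<F> (x - proj A x) \<le> 2 * sigma_hat n r x"
    by (simp add: k(2) z_def)
qed simp

text \<open>With \<open>D = m ` {1..k}\<close>, the vector \<open>1\<^sub>D + 1\<^sub>F\<close> has all nonzero coefficients equal, so
  \<open>A = F \<union> (D - E)\<close> is a greedy set, of order \<open>k\<close>. Removing \<open>A\<close> leaves \<open>1\<^sub>E\<close>, whereas removing the
  first \<open>k\<close> terms of \<open>m\<close> leaves \<open>1\<^sub>F\<close>.\<close>

lemma not_strong_partially_greedyI:
  assumes inj: "inj_on m {1..}" and pos: "\<forall>k\<ge>1. m k \<ge> 1"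
    and bad: "\<And>C. C \<ge> 1 \<Longrightarrow> \<exists>k E F K. E \<in> \<F> \<and> E \<subseteq> m ` {1..k} \<and> finite F \<and>
        F \<subseteq> {1..} - m ` {1..k} \<and> card F = card E \<and> (\<forall>S\<in>\<F>. card (S \<inter> F) \<le> K) \<and>
        C * real K < real (card E)"
  shows "\<not> banach_basis.strong_partially_greedy
     (seq_scale :: 'k::{real_normed_field,banach,second_countable_topology} \<Rightarrow> _)
     (family_space \<F>) (family_norm \<F>) coord_vec (\<lambda>i x. x i) m"
  unfolding banach_basis.strong_partially_greedy_def[OF banach_basis_coord_vec]
proof clarify
  interpret banach_basis seq_scale "family_space \<F> :: (nat \<Rightarrow> 'k) set" "family_norm \<F>"
    coord_vec "\<lambda>i x. x i"
    by (rule banach_basis_coord_vec)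
  fix C :: real
  assume "1 \<le> C" and spg: "\<forall>x\<in>family_space \<F>. \<forall>r\<ge>1. \<forall>A. greedy_set x r A \<longrightarrow>
    family_norm \<F> (x - proj A (x :: nat \<Rightarrow> 'k)) \<le> C * sigma_hat m r x"
  from bad[OF this(1)] obtain k E F K where E: "E \<in> \<F>" "E \<subseteq> m ` {1..k}"
    and F: "finite F" "F \<subseteq> {1..} - m ` {1..k}" "card F = card E"
    and K: "\<And>S. S \<in> \<F> \<Longrightarrow> card (S \<inter> F) \<le> K" and large: "C * real K < real (card E)"
    by blast
  define D where "D = m ` {1..k}"
  define x :: "nat \<Rightarrow> 'k" where "x = (\<lambda>i. if i \<in> D \<union> F then 1 else 0)"
  define A where "A = F \<union> (D - E)"
  have "finite D" by (simp add: D_def)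
  have "D \<subseteq> {1..}" using pos by (auto simp: D_def)
  have "card D = k"
    using inj by (simp add: D_def card_image inj_on_subset)
  have "C * real K \<ge> 0" using \<open>1 \<le> C\<close> by simp
  then have "E \<noteq> {}" using large by auto
  then have "k \<ge> 1" using E(2) by (cases "k = 0") auto
  have x: "x \<in> family_space \<F>"
    using \<open>finite D\<close> F(1,2) \<open>D \<subseteq> {1..}\<close>
    by (intro finitely_supported_in_family_space[of _ "Max (D \<union> F)"]) (auto simp: x_def leD)
  have "F \<inter> (D - E) = {}" using F(2) by (auto simp: D_def)
  then have "card A = card F + card (D - E)"
    using F(1) \<open>finite D\<close> unfolding A_def by (intro card_Un_disjoint) auto
  also have "card (D - E) = card D - card E"
    using E by (intro card_Diff_subset) (auto simp: D_def finite_sets)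
  finally have "card A = k"
    using F(3) card_mono[OF \<open>finite D\<close>, of E] E(2) \<open>card D = k\<close> by (simp add: D_def)
  then have "greedy_set x k A"
    using F \<open>finite D\<close> \<open>D \<subseteq> {1..}\<close> by (auto simp: greedy_set_def A_def x_def)
  then have spg': "family_norm \<F> (x - proj A x) \<le> C * sigma_hat m k x"
    using spg x \<open>k \<ge> 1\<close> by blast
  have finA: "finite A" using F \<open>finite D\<close> by (simp add: A_def)
  have "proj A x = (\<lambda>i. if i \<in> A then x i else 0)"
    unfolding proj_def by (rule sum_seq_scale_coord_vec[OF finA])
  then have "x - proj A x = (\<lambda>i. if i \<in> E then 1 else 0)"
    using E(2) F(2) unfolding x_def A_def D_def by (intro ext) auto
  then have "real (card E) \<le> family_norm \<F> (x - proj A x)"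
    using card_le_family_norm_indicator[OF E(1)] by metis
  also note spg'
  also have "sigma_hat m k x \<le> family_norm \<F> (x - seq_psum m k x)"
    unfolding sigma_hat_def by (intro Min_le) auto
  also have "x - seq_psum m k x = (\<lambda>i. if i \<in> F then 1 else 0)"
    using F(2) by (auto simp: seq_psum_coord_vec[OF inj] fun_eq_iff x_def D_def)
  also have "family_norm \<F> (\<lambda>i. if i \<in> F then 1 else 0 :: 'k) \<le> real K"
    by (rule family_norm_indicator_le[OF K])
  finally show False using large \<open>1 \<le> C\<close> by (simp add: mult_left_mono)
qed

lemma not_democraticI:
  assumes bad: "\<And>C. C \<ge> 1 \<Longrightarrow> \<exists>E F K. E \<in> \<F> \<and> E \<subseteq> n ` {1..} \<and> finite F \<and>
        F \<subseteq> {1..} \<and> card F = card E \<and> (\<forall>S\<in>\<F>. card (S \<inter> F) \<le> K) \<and>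
        C * real K < real (card E)"
  shows "\<not> banach_basis.democratic (family_norm \<F>)
     (coord_vec :: nat \<Rightarrow> nat \<Rightarrow> 'k::{real_normed_field,banach,second_countable_topology}) n"
  unfolding banach_basis.democratic_def[OF banach_basis_coord_vec]
proof clarify
  fix C :: real
  assume "1 \<le> C" and dem: "\<forall>A B. finite A \<and> finite B \<and> A \<subseteq> {1..} \<and> B \<subseteq> {1..} \<and> A \<subseteq> n ` {1..} \<and>
    card A \<le> card B \<longrightarrow> family_norm \<F> (\<Sum>i\<in>A. coord_vec i :: nat \<Rightarrow> 'k) \<le>
      C * family_norm \<F> (\<Sum>i\<in>B. coord_vec i :: nat \<Rightarrow> 'k)"
  from bad[OF this(1)] obtain E F K where E: "E \<in> \<F>" "E \<subseteq> n ` {1..}"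
    and F: "finite F" "F \<subseteq> {1..}" "card F = card E"
    and K: "\<And>S. S \<in> \<F> \<Longrightarrow> card (S \<inter> F) \<le> K" and large: "C * real K < real (card E)"
    by blast
  have sum: "(\<Sum>i\<in>A. coord_vec i :: nat \<Rightarrow> 'k) = (\<lambda>i. if i \<in> A then 1 else 0)" if "finite A" for A
    using sum_seq_scale_coord_vec[OF that, of "\<lambda>_. 1 :: 'k"] by (simp add: seq_scale_def)
  have "real (card E) \<le> family_norm \<F> (\<Sum>i\<in>E. coord_vec i :: nat \<Rightarrow> 'k)"
    using card_le_family_norm_indicator[OF E(1)] sum finite_sets[OF E(1)] by simp
  also have "\<dots> \<le> C * family_norm \<F> (\<Sum>i\<in>F. coord_vec i :: nat \<Rightarrow> 'k)"
    using dem E F finite_sets[OF E(1)] positive_sets[OF E(1)] by simp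
  also have "family_norm \<F> (\<Sum>i\<in>F. coord_vec i :: nat \<Rightarrow> 'k) \<le> real K"
    unfolding sum[OF F(1)] by (rule family_norm_indicator_le[OF K])
  finally show False using large \<open>1 \<le> C\<close> by (simp add: mult_left_mono)
qed

end

section \<open>Families whose cardinality bound grows slowly along a given set\<close>

text \<open>A Schreier-type family, with the cardinality restricted only at the elements of \<open>J\<close>. The successor
  keeps the singletons in the family where \<open>h\<close> vanishes.\<close>

definition slow_family :: "nat set \<Rightarrow> (nat \<Rightarrow> nat) \<Rightarrow> nat set set" where
  "slow_family J h = {S. finite S \<and> S \<subseteq> {1..} \<and> (\<forall>i\<in>S \<inter> J. card S \<le> Suc (h i))}"

lemma hereditary_slow_family: "hereditary_family (slow_family J h)"
proof
  fix S T :: "nat set"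
  assume S: "S \<in> slow_family J h" and "T \<subseteq> S"
  then have "finite T" "card T \<le> card S"
    by (auto simp: slow_family_def intro: card_mono finite_subset)
  moreover have "card T \<le> Suc (h i)" if "i \<in> T \<inter> J" for i
  proof -
    have "card S \<le> Suc (h i)"
      using that S \<open>T \<subseteq> S\<close> unfolding slow_family_def by blast
    with \<open>card T \<le> card S\<close> show ?thesis by (rule order.trans)
  qed
  ultimately show "T \<in> slow_family J h"
    using S \<open>T \<subseteq> S\<close> unfolding slow_family_def by blast
qed (auto simp: slow_family_def)

text \<open>Every element of \<open>T\<close> that is a term of \<open>n\<close> comes after \<open>n k\<close>, hence after all elements of \<open>S\<close>, so
  by monotonicity of \<open>h\<close> it tolerates at least the cardinality of \<open>S\<close>.\<close>

lemma slow_family_shift_later: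
  fixes n h :: "nat \<Rightarrow> nat"
  assumes n: "strict_mono_on {1..} n" and "mono h"
    and S: "S \<in> slow_family (n ` {1..}) h" "S \<subseteq> n ` {1..k}"
    and T: "finite T" "T \<subseteq> {1..} - n ` {1..k}" "card T = card S"
  shows "T \<in> slow_family (n ` {1..}) h"
proof (cases "S = {}")
  case False
  then obtain i where i: "i \<in> {1..k}" "n i \<in> S" using S(2) by blast
  have "card S \<le> Suc (h (n i))"
    using S(1) i by (auto simp: slow_family_def)
  have "card T \<le> Suc (h (n j))" if j: "j \<ge> 1" "n j \<in> T" for j
  proof -
    have "j > k"
    proof (rule ccontr)
      assume "\<not> j > k"
      then have "n j \<in> n ` {1..k}" using j(1) by (intro imageI) simp
      then show False using T(2) j(2) by blast
    qed
    then have "n i \<le> n j" using strict_mono_onD[OF n, of i j] i(1) j(1) by simp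
    then have "h (n i) \<le> h (n j)" by (rule monoD[OF \<open>mono h\<close>])
    then show ?thesis using \<open>card S \<le> Suc (h (n i))\<close> T(3) by linarith
  qed
  then have "\<forall>i\<in>T \<inter> n ` {1..}. card T \<le> Suc (h i)" by blast
  then show ?thesis using T(1,2) unfolding slow_family_def by blast
qed (use T in \<open>auto simp: slow_family_def\<close>)

lemma finite_subset_initial_segment:
  assumes "finite E" "E \<subseteq> m ` {1..}"
  obtains k :: nat where "E \<subseteq> m ` {1..k}"
proof -
  obtain I where I: "I \<subseteq> {1..}" "finite I" "E = m ` I"
    using finite_subset_image[OF assms] by blast
  have "I \<subseteq> {1..Max I}" using I(1,2) by auto
  then show thesis using I(3) by (intro that[of "Max I"]) blast
qed

text \<open>The order of the quantifiers matters: \<open>F\<close> is fixed before \<open>L\<close>, since the function \<open>h\<close>, from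
  which \<open>L\<close> will come, is built from the sets \<open>F\<close>. If \<open>n\<close> has infinitely many terms outside \<open>m\<close>,
  \<open>F\<close> can consist of such terms, which leaves \<open>E\<close> free to move arbitrarily far out in \<open>m\<close>. Otherwise
  \<open>m\<close> has infinitely many terms outside \<open>n\<close>; a set \<open>E\<close> of these meets the condition on \<open>L\<close> vacuously,
  and \<open>F\<close> consists of terms of \<open>n\<close> outside the initial segment of \<open>m\<close> that covers \<open>E\<close>.\<close>

lemma obtain_separating_sets:
  fixes m n :: "nat \<Rightarrow> nat"
  assumes m: "strict_mono_on {1..} m" and n: "strict_mono_on {1..} n"
    and inf: "infinite ((m ` {1..} - n ` {1..}) \<union> (n ` {1..} - m ` {1..}))"
  shows "\<exists>F. finite F \<and> F \<subseteq> n ` {1..} \<and> card F = N \<and>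
    (\<forall>L. \<exists>k E. finite E \<and> E \<subseteq> m ` {1..k} \<and> card E = N \<and> F \<inter> m ` {1..k} = {} \<and>
      (\<forall>i\<in>E \<inter> n ` {1..}. L < i))"
proof -
  have infinite_range: "infinite (f ` {1..})" if "strict_mono_on {1..} f" for f :: "nat \<Rightarrow> nat"
    using finite_image_iff[OF strict_mono_on_imp_inj_on[OF that]] infinite_Ici by blast
  show ?thesis
  proof (cases "finite (n ` {1..} - m ` {1..})")
    case True
    then have "infinite (m ` {1..} - n ` {1..})" using inf by simp
    then obtain E where E: "finite E" "card E = N" "E \<subseteq> m ` {1..} - n ` {1..}"
      using infinite_arbitrarily_large by blast
    from E(3) have "E \<subseteq> m ` {1..}" by (rule order.trans[OF _ Diff_subset])
    with E(1) obtain k where k: "E \<subseteq> m ` {1..k}" by (rule finite_subset_initial_segment)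
    have "infinite (n ` {1..} - m ` {1..k})"
      using infinite_range[OF n] by (intro Diff_infinite_finite) auto
    then obtain F where "finite F" "card F = N" "F \<subseteq> n ` {1..} - m ` {1..k}"
      using infinite_arbitrarily_large by blast
    then show ?thesis
      using E k by (intro exI[of _ F] conjI allI exI[of _ k] exI[of _ E] ballI; blast)
  next
    case False
    then obtain F where F: "finite F" "card F = N" "F \<subseteq> n ` {1..} - m ` {1..}"
      using infinite_arbitrarily_large by blast
    have "\<exists>k E. finite E \<and> E \<subseteq> m ` {1..k} \<and> card E = N \<and> F \<inter> m ` {1..k} = {} \<and>
      (\<forall>i\<in>E \<inter> n ` {1..}. L < i)" for L
    proof -
      have "infinite (m ` {1..} - {..L})"
        using infinite_range[OF m] by (intro Diff_infinite_finite) auto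
      then obtain E where E: "finite E" "card E = N" "E \<subseteq> m ` {1..} - {..L}"
        using infinite_arbitrarily_large by blast
      from E(3) have "E \<subseteq> m ` {1..}" by (rule order.trans[OF _ Diff_subset])
      with E(1) obtain k where k: "E \<subseteq> m ` {1..k}" by (rule finite_subset_initial_segment)
      have "m ` {1..k} \<subseteq> m ` {1..}" by (intro image_mono) auto
      then have "F \<inter> m ` {1..k} = {}" using F(3) by blast
      moreover have "L < i" if "i \<in> E" for i
        using subsetD[OF E(3) that] by simp
      ultimately show ?thesis
        using E(1,2) k by (intro exI[of _ k] exI[of _ E] conjI ballI) auto
    qed
    moreover have "F \<subseteq> n ` {1..}" using F(3) by blast
    ultimately show ?thesis using F(1,2) by (intro exI[of _ F] conjI allI)
  qed
qed

text \<open>If \<open>b j\<close> bounds the set \<open>F j\<close>, the function \<open>h\<close> that jumps above \<open>j\<close> only beyond \<open>b j\<close> is slow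
  enough. Including \<open>j\<close> itself in the bound makes \<open>b\<close> unbounded, so that \<open>h\<close> is defined
  everywhere.\<close>

lemma slow_function_exists:
  fixes F :: "nat \<Rightarrow> nat set"
  assumes "\<And>j. finite (F j)"
  obtains h :: "nat \<Rightarrow> nat" where "mono h" "\<And>i j. i \<in> F j \<Longrightarrow> h i \<le> j"
    "\<And>K. \<exists>L. \<forall>i>L. K \<le> h i"
proof -
  define b where "b j = Max (insert j (F j))" for j
  define h where "h i = (LEAST j. i \<le> b j)" for i
  have b: "j \<le> b j" "i \<in> F j \<Longrightarrow> i \<le> b j" for i j
    using assms[of j] by (auto simp: b_def intro: Max_ge)
  have h: "i \<le> b (h i)" for i
    unfolding h_def by (rule LeastI[of _ i]) (rule b)
  show thesis
  proof (rule that)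
    show "mono h"
    proof (rule monoI)
      fix i i' :: nat assume "i \<le> i'"
      then have "i \<le> b (h i')" using h[of i'] by linarith
      then show "h i \<le> h i'" unfolding h_def[of i] by (rule Least_le)
    qed
    show "h i \<le> j" if "i \<in> F j" for i j
      unfolding h_def using b(2)[OF that] by (rule Least_le)
    show "\<exists>L. \<forall>i>L. K \<le> h i" for K
    proof (intro exI allI impI)
      fix i assume i: "Max (b ` {..K}) < i"
      show "K \<le> h i"
      proof (rule ccontr)
        assume "\<not> K \<le> h i"
        then have "b (h i) \<le> Max (b ` {..K})" by (intro Max_ge) auto
        then show False using h[of i] i by linarith
      qed
    qed
  qed
qed

section \<open>A basis that separates the two sequences\<close>

lemma separating_basis_exists:
  fixes m n :: "nat \<Rightarrow> nat"
  assumes m: "strict_mono_on {1..} m" and m_pos: "\<forall>k\<ge>1. m k \<ge> 1"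
    and n: "strict_mono_on {1..} n" and n_pos: "\<forall>k\<ge>1. n k \<ge> 1"
    and inf: "infinite ((m ` {1..} - n ` {1..}) \<union> (n ` {1..} - m ` {1..}))"
  shows "\<exists>X N e (es :: nat \<Rightarrow> (nat \<Rightarrow> 'k) \<Rightarrow> 'k::{real_normed_field,banach,second_countable_topology}).
            banach_basis seq_scale X N e es \<and>
            banach_basis.one_unconditional seq_scale N e \<and>
            banach_basis.strong_partially_greedy seq_scale X N e es n \<and>
            \<not> banach_basis.strong_partially_greedy seq_scale X N e es m \<and>
            \<not> banach_basis.democratic N e n"
proof -
  let ?J = "n ` {1..}"
  have inj: "inj_on m {1..}" "inj_on n {1..}"
    using m n by (auto intro: strict_mono_on_imp_inj_on)
  have J_pos: "?J \<subseteq> {1..}" using n_pos by auto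
  have "\<forall>j. \<exists>F. finite F \<and> F \<subseteq> ?J \<and> card F = (Suc j)\<^sup>2 \<and>
    (\<forall>L. \<exists>k E. finite E \<and> E \<subseteq> m ` {1..k} \<and> card E = (Suc j)\<^sup>2 \<and> F \<inter> m ` {1..k} = {} \<and>
      (\<forall>i\<in>E \<inter> ?J. L < i))"
    by (intro allI obtain_separating_sets[OF m n inf])
  then obtain F where sets: "\<forall>j. finite (F j) \<and> F j \<subseteq> ?J \<and> card (F j) = (Suc j)\<^sup>2 \<and>
    (\<forall>L. \<exists>k E. finite E \<and> E \<subseteq> m ` {1..k} \<and> card E = (Suc j)\<^sup>2 \<and> F j \<inter> m ` {1..k} = {} \<and>
      (\<forall>i\<in>E \<inter> ?J. L < i))"
    by (rule choice[elim_format]) (elim exE)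
  have F: "finite (F j)" "F j \<subseteq> ?J" "card (F j) = (Suc j)\<^sup>2" for j
    using spec[OF sets, of j] by simp_all
  have late: "\<exists>k E. finite E \<and> E \<subseteq> m ` {1..k} \<and> card E = (Suc j)\<^sup>2 \<and>
      F j \<inter> m ` {1..k} = {} \<and> (\<forall>i\<in>E \<inter> ?J. L < i)" for j L
    using spec[OF sets, of j] by (elim conjE) (rule spec)
  obtain h where h: "mono h" "\<And>i j. i \<in> F j \<Longrightarrow> h i \<le> j" "\<And>K. \<exists>L. \<forall>i>L. K \<le> h i"
    using slow_function_exists[of F, OF F(1)] by metis
  define \<F> where "\<F> = slow_family ?J h"
  interpret hereditary_family \<F>
    unfolding \<F>_def by (rule hereditary_slow_family)
  have small: "card (S \<inter> F j) \<le> Suc j" if S: "S \<in> \<F>" for S j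
  proof (cases "S \<inter> F j = {}")
    case False
    then obtain i where i: "i \<in> S" "i \<in> F j" by blast
    have "card (S \<inter> F j) \<le> card S" using finite_sets[OF S] by (intro card_mono) auto
    also have "\<dots> \<le> Suc (h i)"
      using S i subsetD[OF F(2) i(2)] unfolding \<F>_def slow_family_def by blast
    also have "\<dots> \<le> Suc j" using h(2)[OF i(2)] by simp
    finally show ?thesis .
  qed simp
  have large: "\<exists>L. \<forall>E. finite E \<and> E \<subseteq> {1..} \<and> card E = K \<and> (\<forall>i\<in>E \<inter> ?J. L < i) \<longrightarrow> E \<in> \<F>" for K
  proof -
    obtain L where L: "\<forall>i>L. K \<le> h i" using h(3) by blast
    show ?thesis
    proof (intro exI[of _ L] allI impI)
      fix E
      assume E: "finite E \<and> E \<subseteq> {1..} \<and> card E = K \<and> (\<forall>i\<in>E \<inter> ?J. L < i)"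
      then have "\<forall>i\<in>E \<inter> ?J. card E \<le> Suc (h i)" using L le_SucI by blast
      then show "E \<in> \<F>" using E unfolding \<F>_def slow_family_def by blast
    qed
  qed
  (* The indicator of F j has norm at most j + 1, that of an admissible set of the same size has norm
     (j + 1)^2; the ratio j + 1 beats every constant C. *)
  have gap: "\<exists>j. C * real (Suc j) < real ((Suc j)\<^sup>2)" for C :: real
  proof -
    obtain j where "C < real j" using reals_Archimedean2 by blast
    then have "C < real (Suc j)" by simp
    then have "C * real (Suc j) < real (Suc j) * real (Suc j)"
      by (intro mult_strict_right_mono) simp_all
    then show ?thesis
      unfolding power2_eq_square of_nat_mult[symmetric] by blast
  qed
  show ?thesis
  proof (intro exI conjI)
    show "banach_basis seq_scale (family_space \<F> :: (nat \<Rightarrow> 'k) set) (family_norm \<F>)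
        coord_vec (\<lambda>i x. x i)"
      by (rule banach_basis_coord_vec)
    show "banach_basis.one_unconditional (seq_scale :: 'k \<Rightarrow> _) (family_norm \<F>) coord_vec"
      by (rule one_unconditional_coord_vec)
    show "banach_basis.strong_partially_greedy (seq_scale :: 'k \<Rightarrow> _)
        (family_space \<F>) (family_norm \<F>) coord_vec (\<lambda>i x. x i) n"
      by (rule strong_partially_greedy_if_later_sets[OF inj(2)])
        (unfold \<F>_def, rule slow_family_shift_later[OF n h(1)])
    show "\<not> banach_basis.strong_partially_greedy (seq_scale :: 'k \<Rightarrow> _)
        (family_space \<F>) (family_norm \<F>) coord_vec (\<lambda>i x. x i) m"
    proof (rule not_strong_partially_greedyI[OF inj(1) m_pos])
      fix C :: real
      obtain j where j: "C * real (Suc j) < real ((Suc j)\<^sup>2)" using gap by blast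
      obtain L where L: "\<forall>E. finite E \<and> E \<subseteq> {1..} \<and> card E = (Suc j)\<^sup>2 \<and>
          (\<forall>i\<in>E \<inter> ?J. L < i) \<longrightarrow> E \<in> \<F>"
        using large by blast
      obtain k E where E: "finite E" "E \<subseteq> m ` {1..k}" "card E = (Suc j)\<^sup>2"
        "F j \<inter> m ` {1..k} = {}" "\<forall>i\<in>E \<inter> ?J. L < i"
        using late[of j L] by blast
      have "m ` {1..k} \<subseteq> {1..}" using m_pos by auto
      with E(2) have "E \<subseteq> {1..}" by (rule order.trans)
      then have "E \<in> \<F>" using E(1,3,5) L by blast
      moreover have "F j \<subseteq> {1..} - m ` {1..k}" using F(2)[of j] J_pos E(4) by blast
      ultimately show "\<exists>k E F K. E \<in> \<F> \<and> E \<subseteq> m ` {1..k} \<and> finite F \<and>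
        F \<subseteq> {1..} - m ` {1..k} \<and> card F = card E \<and> (\<forall>S\<in>\<F>. card (S \<inter> F) \<le> K) \<and>
        C * real K < real (card E)"
        using E(2,3) j F(1,3) small
        by (intro exI[of _ k] exI[of _ E] exI[of _ "F j"] exI[of _ "Suc j"] conjI ballI) simp_all
    qed
    show "\<not> banach_basis.democratic (family_norm \<F>) (coord_vec :: nat \<Rightarrow> nat \<Rightarrow> 'k) n"
    proof (rule not_democraticI)
      fix C :: real
      obtain j where j: "C * real (Suc j) < real ((Suc j)\<^sup>2)" using gap by blast
      obtain L where L: "\<forall>E. finite E \<and> E \<subseteq> {1..} \<and> card E = (Suc j)\<^sup>2 \<and>
          (\<forall>i\<in>E \<inter> ?J. L < i) \<longrightarrow> E \<in> \<F>"
        using large by blast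
      have "infinite ?J"
        using finite_image_iff[OF inj(2)] infinite_Ici by blast
      then have "infinite (?J - {..L})" by (intro Diff_infinite_finite) auto
      then obtain E where E: "finite E" "card E = (Suc j)\<^sup>2" "E \<subseteq> ?J - {..L}"
        using infinite_arbitrarily_large by blast
      have "\<forall>i\<in>E \<inter> ?J. L < i" using E(3) by (auto simp: subset_iff)
      moreover have EJ: "E \<subseteq> ?J" using E(3) by blast
      ultimately have "E \<in> \<F>" using E(1,2) J_pos L by (meson order.trans)
      moreover have "F j \<subseteq> {1..}" using F(2) J_pos by (rule order.trans)
      ultimately show "\<exists>E F K. E \<in> \<F> \<and> E \<subseteq> n ` {1..} \<and> finite F \<and>
        F \<subseteq> {1..} \<and> card F = card E \<and> (\<forall>S\<in>\<F>. card (S \<inter> F) \<le> K) \<and>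
        C * real K < real (card E)"
        using E(2) EJ j F(1,3) small
        by (intro exI[of _ E] exI[of _ "F j"] exI[of _ "Suc j"] conjI ballI) simp_all
    qed
  qed
qed

theorem theorem3p8:
  fixes m n :: "nat \<Rightarrow> nat"
  assumes "strict_mono_on {1..} m" and "\<forall>k\<ge>1. m k \<ge> 1"
    and "strict_mono_on {1..} n" and "\<forall>k\<ge>1. n k \<ge> 1"
    and "infinite ((m ` {1..} - n ` {1..}) \<union> (n ` {1..} - m ` {1..}))"
  shows "(\<exists>X N e (es :: nat \<Rightarrow> (nat \<Rightarrow> real) \<Rightarrow> real).
            banach_basis seq_scale X N e es \<and>
            banach_basis.one_unconditional seq_scale N e \<and>
            banach_basis.strong_partially_greedy seq_scale X N e es n \<and>
            \<not> banach_basis.strong_partially_greedy seq_scale X N e es m \<and>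
            \<not> banach_basis.democratic N e n) \<and>
         (\<exists>X N e (es :: nat \<Rightarrow> (nat \<Rightarrow> complex) \<Rightarrow> complex).
            banach_basis seq_scale X N e es \<and>
            banach_basis.one_unconditional seq_scale N e \<and>
            banach_basis.strong_partially_greedy seq_scale X N e es n \<and>
            \<not> banach_basis.strong_partially_greedy seq_scale X N e es m \<and>
            \<not> banach_basis.democratic N e n)"
  using separating_basis_exists[OF assms, where 'k = real]
    separating_basis_exists[OF assms, where 'k = complex] by (rule conjI)

end
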